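(* Let $\mathcal{H}$ be a real Hilbert space, let $m\ge1$ be an integer, let $T_1,\ldots,T_m:\mathcal{H}\to\mathcal{H}$ be affine isometries with $\bigcap_{j=1}^m\operatorname{Fix}T_j\ne\varnothing$, and set $\mathcal{S}:=\{T_1,\ldots,T_m\}$ and $\mathcal{S}(x):=\{T_1x,\ldots,T_mx\}$ for $x\in\mathcal{H}$. Let $W$ be a nonempty closed affine subspace of $\mathcal{H}$ contained in $\bigcap_{i=1}^m\operatorname{Fix}T_i$. Assume that $\mathrm{Id}\in\mathcal{S}$ and that there exist $F:\mathcal{H}\to\mathcal{H}$ and $\gamma\in[0,1[$ such that $Fx\in\operatorname{aff}(\mathcal{S}(x))$ and $\|Fx-\mathrm{P}_Wx\|\le\gamma\|x-\mathrm{P}_Wx\|$ for all $x\in\mathcal{H}$. Then the circumcenter mapping $CC_{\mathcal{S}}$ is a $\gamma$-BAM and $\operatorname{Fix}CC_{\mathcal{S}}=\bigcap_{i=1}^m\operatorname{Fix}T_i$.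
   Context: For a nonempty closed convex set $C\subseteq\mathcal{H}$, $\mathrm{P}_C$ denotes the metric projection onto $C$. $\operatorname{Fix}G=\{x\in\mathcal{H}: Gx=x\}$. $\operatorname{aff}K$ is the affine hull of $K$. An isometry is a map $T$ with $\|Tx-Ty\|=\|x-y\|$ for all $x,y$. Definition (BAM). Let $G:\mathcal{H}\to\mathcal{H}$ and $\gamma\in[0,1[$. $G$ is a best approximation mapping with constant $\gamma$ ($\gamma$-BAM) if (1) $\operatorname{Fix}G$ is a nonempty closed convex subset of $\mathcal{H}$; (2) $\mathrm{P}_{\operatorname{Fix}G}G=\mathrm{P}_{\operatorname{Fix}G}$; (3) $\|Gx-\mathrm{P}_{\operatorname{Fix}G}x\|\le\gamma\|x-\mathrm{P}_{\operatorname{Fix}G}x\|$ for all $x\in\mathcal{H}$. Circumcenter mapping: for a finite set $\mathcal{S}$ of affine isometries of $\mathcal{H}$ having a common fixed point, and $x\in\mathcal{H}$, $CC_{\mathcal{S}}x$ is the unique point $p\in\operatorname{aff}(\mathcal{S}(x))$, where $\mathcal{S}(x)=\{Tx:T\in\mathcal{S}\}$, such that $\{\|p-Tx\|:T\in\mathcal{S}\}$ is a singleton. It is a known fact that such a point exists and is unique for every $x$, so $CC_{\mathcal{S}}:\mathcal{H}\to\mathcal{H}$ is well defined. *)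

theory Defs
  imports "HOL-Analysis.Analysis"
begin

definition Fix :: "('a \<Rightarrow> 'a) \<Rightarrow> 'a set" where
  "Fix G = {x. G x = x}"

definition affine_map :: "('a::real_vector \<Rightarrow> 'b::real_vector) \<Rightarrow> bool" where
  "affine_map T \<longleftrightarrow>
     (\<forall>x y. \<forall>t::real. T ((1 - t) *\<^sub>R x + t *\<^sub>R y) = (1 - t) *\<^sub>R T x + t *\<^sub>R T y)"

(* Surjectivity is not required. *)
definition isometry :: "('a::real_normed_vector \<Rightarrow> 'b::real_normed_vector) \<Rightarrow> bool" where
  "isometry T \<longleftrightarrow> (\<forall>x y. norm (T x - T y) = norm (x - y))"

(* The library's closest_point is restricted to heine_borel types, which would exclude
   infinite-dimensional Hilbert spaces.  The description is unique when C is a nonempty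
   closed convex subset of a Hilbert space. *)
definition metric_proj :: "'a::real_inner set \<Rightarrow> 'a \<Rightarrow> 'a" where
  "metric_proj C x = (THE p. p \<in> C \<and> (\<forall>y\<in>C. norm (x - p) \<le> norm (x - y)))"

definition BAM :: "real \<Rightarrow> ('a::{real_inner,complete_space} \<Rightarrow> 'a) \<Rightarrow> bool" where
  "BAM \<gamma> G \<longleftrightarrow>
     0 \<le> \<gamma> \<and> \<gamma> < 1 \<and>
     Fix G \<noteq> {} \<and> closed (Fix G) \<and> convex (Fix G) \<and>
     metric_proj (Fix G) \<circ> G = metric_proj (Fix G) \<and>
     (\<forall>x. norm (G x - metric_proj (Fix G) x) \<le> \<gamma> * norm (x - metric_proj (Fix G) x))"

definition images_at :: "('a \<Rightarrow> 'b) set \<Rightarrow> 'a \<Rightarrow> 'b set" where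
  "images_at S x = {T x | T. T \<in> S}"

(* The description is unique when S is a nonempty finite set of affine isometries with a
   common fixed point; otherwise the value may be unspecified. *)
definition CC :: "('a::{real_inner,complete_space} \<Rightarrow> 'a) set \<Rightarrow> 'a \<Rightarrow> 'a" where
  "CC S x = (THE p. p \<in> affine hull (images_at S x) \<and>
                    is_singleton {norm (p - T x) | T. T \<in> S})"

end

theory Submission
  imports Defs
begin

text \<open>For every \<open>w\<close> in the common fixed point set, isometry makes \<open>w\<close> equidistant from all points
  of \<open>S(x)\<close>, so the circumcenter of \<open>S(x)\<close> is the orthogonal projection of \<open>w\<close> onto \<open>aff S(x)\<close>.
  Pythagoras then gives \<open>\<parallel>q - w\<parallel>\<^sup>2 = \<parallel>q - CC x\<parallel>\<^sup>2 + \<parallel>CC x - w\<parallel>\<^sup>2\<close> for all \<open>q \<in> aff S(x)\<close>.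
  With \<open>q = F x\<close> the circumcenter inherits the contraction estimate of \<open>F\<close>; with \<open>q = x\<close> the
  points \<open>x\<close> and \<open>CC x\<close> have the same nearest point in \<open>W\<close>. On common fixed points \<open>aff S(x)\<close> is
  a singleton, so the estimate forces the common fixed point set to be \<open>W\<close>.\<close>

section \<open>Projections in Hilbert spaces\<close>

text \<open>Parallelogram law: the midpoint of \<open>y\<close> and \<open>z\<close> stays in
  \<open>C\<close>, so its distance to \<open>x\<close> is at least \<open>d\<close>. Slack
  \<open>e > 0\<close> yields shrinking diameters, and \<open>e = 0\<close> yields uniqueness of
  nearest points.\<close>

lemma convex_near_minimal_dist:
  fixes x :: "'a::real_inner"
  assumes "convex C" "y \<in> C" "z \<in> C" "0 \<le> d" "\<And>c. c \<in> C \<Longrightarrow> d \<le> norm (x - c)"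
    and "(norm (x - y))\<^sup>2 \<le> d\<^sup>2 + e" "(norm (x - z))\<^sup>2 \<le> d\<^sup>2 + e"
  shows "(norm (y - z))\<^sup>2 \<le> 4 * e"
proof -
  let ?m = "(1/2) *\<^sub>R y + (1/2) *\<^sub>R z"
  have "?m \<in> C"
    using assms(1-3) by (intro convexD) auto
  then have "d\<^sup>2 \<le> (norm (x - ?m))\<^sup>2"
    using assms(4,5) by (simp add: power_mono)
  moreover have "(norm (y - z))\<^sup>2 =
      2 * (norm (x - y))\<^sup>2 + 2 * (norm (x - z))\<^sup>2 - 4 * (norm (x - ?m))\<^sup>2"
    unfolding power2_norm_eq_inner
    by (simp add: inner_diff_left inner_diff_right inner_add_left inner_add_right
        inner_commute algebra_simps)
  ultimately show ?thesis
    using assms(6,7) by linarith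
qed

text \<open>The near-minimizers form a decreasing sequence of nonempty closed sets whose diameters
  tend to 0, so completeness gives a common point.\<close>

lemma nearest_point_exists:
  fixes x :: "'a::{real_inner,complete_space}"
  assumes "closed C" "convex C" "C \<noteq> {}"
  shows "\<exists>p\<in>C. \<forall>y\<in>C. norm (x - p) \<le> norm (x - y)"
proof -
  define d where "d = (INF c\<in>C. norm (x - c))"
  have bdd: "bdd_below ((\<lambda>c. norm (x - c)) ` C)"
    by (rule bdd_belowI[of _ 0]) auto
  have d_le: "d \<le> norm (x - c)" if "c \<in> C" for c
    unfolding d_def using bdd that by (rule cINF_lower)
  have d0: "0 \<le> d"
    unfolding d_def using assms(3) by (intro cINF_greatest) auto
  \<comment> \<open>The slack is added to the squared distance, which is the form that the midpoint
    estimate takes; it bounds squared diameters by \<open>4 / Suc n\<close>.\<close>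
  define N where "N n = C \<inter> cball x (sqrt (d\<^sup>2 + 1 / real (Suc n)))" for n
  have N_iff: "c \<in> N n \<longleftrightarrow> c \<in> C \<and> (norm (x - c))\<^sup>2 \<le> d\<^sup>2 + 1 / real (Suc n)" for c n
    using real_le_rsqrt[of "norm (x - c)" "d\<^sup>2 + 1 / real (Suc n)"]
      sqrt_ge_absD[of "norm (x - c)" "d\<^sup>2 + 1 / real (Suc n)"]
    unfolding N_def mem_cball dist_norm Int_iff abs_norm_cancel by blast
  obtain a where a: "\<And>n. a \<in> N n"
  proof (rule decreasing_closed_nest[of N])
    show "closed (N n)" for n
      unfolding N_def using assms(1) by auto
    show "N n \<noteq> {}" for n
    proof -
      have "d < sqrt (d\<^sup>2 + 1 / real (Suc n))"
        using d0 by (intro real_less_rsqrt) simp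
      then obtain c where "c \<in> C" "norm (x - c) < sqrt (d\<^sup>2 + 1 / real (Suc n))"
        unfolding d_def using cINF_less_iff[OF assms(3) bdd] by blast
      then show ?thesis
        unfolding N_def by (auto simp: dist_norm intro: less_imp_le)
    qed
    show "N n \<subseteq> N m" if "m \<le> n" for m n
    proof -
      have "1 / real (Suc n) \<le> 1 / real (Suc m)"
        using that by (intro divide_left_mono) auto
      then show ?thesis
        unfolding subset_iff N_iff by (auto intro: order_trans)
    qed
    show "\<exists>n. \<forall>y\<in>N n. \<forall>z\<in>N n. dist y z < e" if "0 < e" for e
    proof -
      have "0 < e\<^sup>2 / 4"
        using that by simp
      then obtain n where n: "1 / real (Suc n) < e\<^sup>2 / 4"
        by (rule nat_approx_posE)
      have "dist y z < e" if "y \<in> N n" "z \<in> N n" for y z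
      proof -
        have "(norm (y - z))\<^sup>2 \<le> 4 * (1 / real (Suc n))"
          using that d_le d0 assms(2) unfolding N_iff
          by (intro convex_near_minimal_dist[of C _ _ d x]) auto
        then have "(norm (y - z))\<^sup>2 < e\<^sup>2"
          using n by linarith
        then show ?thesis
          using \<open>0 < e\<close> by (simp add: dist_norm power2_less_imp_less)
      qed
      then show ?thesis by blast
    qed
  qed blast
  have "(norm (x - a))\<^sup>2 \<le> d\<^sup>2"
  proof (rule field_le_epsilon)
    fix e :: real assume "0 < e"
    then obtain n where "1 / real (Suc n) < e"
      using nat_approx_posE by blast
    then show "(norm (x - a))\<^sup>2 \<le> d\<^sup>2 + e"
      using a[of n] unfolding N_iff by linarith
  qed
  then have "norm (x - a) \<le> d"
    using d0 by (rule power2_le_imp_le)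
  then show ?thesis
    using a[of 0] d_le unfolding N_iff by (meson order_trans)
qed

lemma metric_proj_mem:
  fixes x :: "'a::{real_inner,complete_space}"
  assumes "closed C" "convex C" "C \<noteq> {}"
  shows "metric_proj C x \<in> C"
proof -
  obtain p where p: "p \<in> C" "\<forall>y\<in>C. norm (x - p) \<le> norm (x - y)"
    using nearest_point_exists[OF assms] by blast
  have "metric_proj C x = p"
    unfolding metric_proj_def
  proof (rule the_equality)
    fix q assume q: "q \<in> C \<and> (\<forall>y\<in>C. norm (x - q) \<le> norm (x - y))"
    have "norm (x - q) = norm (x - p)"
      using p q by (simp add: antisym)
    \<comment> \<open>Two minimizers have zero slack over the minimal distance.\<close>
    then have "(norm (q - p))\<^sup>2 \<le> 4 * 0"
      using p q assms(2) by (intro convex_near_minimal_dist[of C _ _ "norm (x - p)" x]) auto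
    then show "q = p" by simp
  qed (use p in blast)
  then show ?thesis using p by simp
qed

text \<open>Gram-Schmidt: with \<open>r\<close> the projection of \<open>b\<close> onto
  \<open>span B\<close>, the vector \<open>b - r\<close> is the new orthogonal direction, along
  which the projection \<open>p\<close> of \<open>x\<close> is corrected.\<close>

lemma span_projection_exists:
  fixes x :: "'a::real_inner"
  assumes "finite B"
  shows "\<exists>p\<in>span B. \<forall>b\<in>B. (x - p) \<bullet> b = 0"
  using assms
proof (induction B arbitrary: x)
  case (insert b B)
  obtain p where p: "p \<in> span B" "\<forall>c\<in>B. (x - p) \<bullet> c = 0"
    using insert.IH by blast
  obtain r where r: "r \<in> span B" "\<forall>c\<in>B. (b - r) \<bullet> c = 0"
    using insert.IH by blast
  have mono: "u \<in> span (insert b B)" if "u \<in> span B" for u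
    using that span_mono[of B "insert b B"] by blast
  have b: "b \<in> span (insert b B)"
    by (simp add: span_base)
  \<comment> \<open>If \<open>b\<close> already lies in \<open>span B\<close>, then
    \<open>b = r\<close> and the correction vanishes, so \<open>q = p\<close>.\<close>
  define q where "q = p + ((x - p) \<bullet> (b - r) / ((b - r) \<bullet> (b - r))) *\<^sub>R (b - r)"
  have "q \<in> span (insert b B)"
    unfolding q_def by (intro span_add span_scale span_diff mono b p(1) r(1))
  moreover have qB: "(x - q) \<bullet> c = 0" if "c \<in> B" for c
    using p(2) r(2) that by (simp add: q_def inner_diff_left inner_add_left)
  have "(x - q) \<bullet> r = 0"
    using orthogonal_to_span[OF r(1), of "x - q"] qB by (simp add: orthogonal_def)
  moreover have "(x - q) \<bullet> (b - r) = 0"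
  proof (cases "b = r")
    case False
    then have "(b - r) \<bullet> (b - r) \<noteq> 0" by simp
    then show ?thesis
      unfolding q_def diff_diff_eq[symmetric] inner_diff_left[of "x - p"] inner_scaleR_left by simp
  qed simp
  ultimately show ?case
    using qB by (auto simp: inner_diff_right)
qed auto

lemma affine_projection_exists:
  fixes w :: "'a::real_inner"
  assumes "finite X" "a \<in> X"
  shows "\<exists>p\<in>affine hull X. \<forall>b\<in>X. (p - w) \<bullet> (b - a) = 0"
proof -
  obtain v where v: "v \<in> span ((\<lambda>b. b - a) ` X)"
      "\<forall>c\<in>(\<lambda>b. b - a) ` X. (w - a - v) \<bullet> c = 0"
    using span_projection_exists[of "(\<lambda>b. b - a) ` X" "w - a"] assms(1) by blast
  \<comment> \<open>The point \<open>a\<close> contributes only the zero vector; dropping it gives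
    the span by which \<open>affine_hull_span2\<close> describes the hull.\<close>
  have "span ((\<lambda>b. b - a) ` X) = span ((\<lambda>b. b - a) ` (X - {a}))"
  proof -
    have "(\<lambda>b. b - a) ` X = insert 0 ((\<lambda>b. b - a) ` (X - {a}))"
      using assms(2) by auto
    then show ?thesis by (simp add: span_insert_0)
  qed
  then have "a + v \<in> affine hull X"
    using v(1) assms(2) by (auto simp: affine_hull_span2)
  moreover have "(a + v - w) \<bullet> (b - a) = 0" if "b \<in> X" for b
  proof -
    have "a + v - w = - (w - a - v)" by simp
    then show ?thesis using v(2) that by (simp only: inner_minus_left) simp
  qed
  ultimately show ?thesis by blast
qed

text \<open>All of \<open>X\<close> lies in one hyperplane with normal \<open>p - w\<close>, hence
  so does its affine hull, and \<open>q - p\<close> is orthogonal to \<open>p - w\<close>.\<close>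

lemma affine_hull_pythagoras:
  fixes p :: "'a::real_inner"
  assumes "p \<in> affine hull X" "q \<in> affine hull X" "\<And>b. b \<in> X \<Longrightarrow> (p - w) \<bullet> (b - a) = 0"
  shows "(norm (q - w))\<^sup>2 = (norm (q - p))\<^sup>2 + (norm (p - w))\<^sup>2"
proof -
  have "affine hull X \<subseteq> {u. (p - w) \<bullet> u = (p - w) \<bullet> a}"
    using assms(3) by (intro hull_minimal affine_hyperplane) (auto simp: inner_diff_right)
  then have "(p - w) \<bullet> q = (p - w) \<bullet> a" "(p - w) \<bullet> p = (p - w) \<bullet> a"
    using assms(1,2) by blast+
  then have "(p - w) \<bullet> (q - p) = 0"
    by (simp add: inner_diff_right)
  then show ?thesis
    using norm_add_Pythagorean[of "q - p" "p - w"] by (simp add: orthogonal_def inner_commute)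
qed

text \<open>Both \<open>p\<close> and \<open>w\<close> satisfy the equation of the perpendicular
  bisector of \<open>a\<close> and \<open>b\<close>; subtracting the two equations cancels the
  quadratic terms.\<close>

lemma equidistant_orthogonal:
  fixes p w :: "'a::real_inner"
  assumes "norm (p - b) = norm (p - a)" "norm (w - b) = norm (w - a)"
  shows "(p - w) \<bullet> (b - a) = 0"
proof -
  have "(norm (p - b))\<^sup>2 = (norm (p - a))\<^sup>2" "(norm (w - b))\<^sup>2 = (norm (w - a))\<^sup>2"
    using assms by auto
  then show ?thesis
    unfolding power2_norm_eq_inner
    by (simp add: inner_diff_left inner_diff_right inner_commute)
qed

section \<open>The circumcenter mapping\<close>

lemma images_at_eq: "images_at S x = (\<lambda>T. T x) ` S"
  by (auto simp: images_at_def)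

lemma CC_properties:
  fixes w x :: "'a::{real_inner,complete_space}"
  assumes "finite S" "S \<noteq> {}" "\<And>T. T \<in> S \<Longrightarrow> norm (w - T x) = r"
  shows CC_mem: "CC S x \<in> affine hull (images_at S x)" (is ?mem)
    and CC_pythagoras: "\<And>q. q \<in> affine hull (images_at S x) \<Longrightarrow>
      (norm (q - w))\<^sup>2 = (norm (q - CC S x))\<^sup>2 + (norm (CC S x - w))\<^sup>2"
proof -
  define A where "A = affine hull (images_at S x)"
  define P where "P p \<longleftrightarrow> p \<in> A \<and> is_singleton {norm (p - T x) | T. T \<in> S}" for p
  obtain U where U: "U \<in> S" using assms(2) by blast
  \<comment> \<open>Stated for every candidate \<open>p\<close>, so that it can serve to prove
    uniqueness before \<open>CC S x\<close> is known to satisfy its description.\<close>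
  have pyth: "(norm (q - w))\<^sup>2 = (norm (q - p))\<^sup>2 + (norm (p - w))\<^sup>2" if "P p" "q \<in> A" for p q
  proof (rule affine_hull_pythagoras)
    show "p \<in> affine hull (images_at S x)" "q \<in> affine hull (images_at S x)"
      using that by (auto simp: P_def A_def)
    fix b assume "b \<in> images_at S x"
    then obtain V where V: "V \<in> S" "b = V x" by (auto simp: images_at_eq)
    obtain s where s: "{norm (p - T x) | T. T \<in> S} = {s}"
      using \<open>P p\<close> by (auto simp: P_def is_singleton_def)
    have "norm (p - T x) = s" if "T \<in> S" for T
      using s that by blast
    then show "(p - w) \<bullet> (b - U x) = 0"
      using U V assms(3) by (intro equidistant_orthogonal) auto
  qed
  \<comment> \<open>The projection of \<open>w\<close> onto the hull is a candidate: by Pythagoras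
    its squared distance to each image is \<open>r\<^sup>2 - (norm (p - w))\<^sup>2\<close>, the
    same for all maps.\<close>
  have "\<exists>p. P p"
  proof -
    obtain p where p: "p \<in> A" "\<forall>b\<in>images_at S x. (p - w) \<bullet> (b - U x) = 0"
      using affine_projection_exists[of "images_at S x" "U x" w] U assms(1)
      by (auto simp: images_at_eq A_def)
    have "norm (p - T x) = norm (p - U x)" if T: "T \<in> S" for T
    proof -
      have sq: "(norm (V x - p))\<^sup>2 = r\<^sup>2 - (norm (p - w))\<^sup>2" if "V \<in> S" for V
      proof -
        have "(norm (V x - w))\<^sup>2 = (norm (V x - p))\<^sup>2 + (norm (p - w))\<^sup>2"
        proof (rule affine_hull_pythagoras)
          show "V x \<in> affine hull (images_at S x)"
            using that by (simp add: images_at_eq hull_inc)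
        qed (use p in \<open>auto simp: A_def\<close>)
        then show ?thesis
          using assms(3)[OF that] by (simp add: norm_minus_commute)
      qed
      then have "(norm (T x - p))\<^sup>2 = (norm (U x - p))\<^sup>2"
        using T U by simp
      then show ?thesis
        by (simp add: norm_minus_commute)
    qed
    then have "{norm (p - T x) | T. T \<in> S} = {norm (p - U x)}"
      using U by blast
    then show ?thesis
      using p(1) by (auto simp: P_def is_singleton_def)
  qed
  moreover have "p = p'" if "P p" "P p'" for p p'
  proof -
    \<comment> \<open>Adding the two identities leaves twice the squared distance of
      \<open>p\<close> and \<open>p'\<close> equal to 0.\<close>
    have "(norm (p' - w))\<^sup>2 = (norm (p' - p))\<^sup>2 + (norm (p - w))\<^sup>2"
      "(norm (p - w))\<^sup>2 = (norm (p - p'))\<^sup>2 + (norm (p' - w))\<^sup>2"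
      using that by (intro pyth; simp add: P_def)+
    then have "(norm (p - p'))\<^sup>2 = 0"
      by (simp add: norm_minus_commute)
    then show ?thesis by simp
  qed
  ultimately have "\<exists>!p. P p"
    by blast
  then have "P (THE p. P p)"
    by (rule theI')
  moreover have "CC S x = (THE p. P p)"
    by (simp only: CC_def P_def A_def)
  ultimately have "P (CC S x)"
    by simp
  then show ?mem
    by (simp add: P_def A_def)
  show "(norm (q - w))\<^sup>2 = (norm (q - CC S x))\<^sup>2 + (norm (CC S x - w))\<^sup>2"
    if "q \<in> affine hull (images_at S x)" for q
    using \<open>P (CC S x)\<close> that unfolding A_def[symmetric] by (rule pyth)
qed

theorem theorem6p10:
  fixes m :: nat
    and T :: "nat \<Rightarrow> 'a::{real_inner,complete_space} \<Rightarrow> 'a"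
    and S :: "('a \<Rightarrow> 'a) set"
    and W :: "'a set"
    and F :: "'a \<Rightarrow> 'a"
    and \<gamma> :: real
  assumes "m \<ge> 1"
    and "\<And>j. j \<in> {1..m} \<Longrightarrow> affine_map (T j)"
    and "\<And>j. j \<in> {1..m} \<Longrightarrow> isometry (T j)"
    and "(\<Inter>j\<in>{1..m}. Fix (T j)) \<noteq> {}"
    and "S = T ` {1..m}"
    and "W \<noteq> {}" and "closed W" and "affine W"
    and "W \<subseteq> (\<Inter>i\<in>{1..m}. Fix (T i))"
    and "id \<in> S"
    and "0 \<le> \<gamma>" and "\<gamma> < 1"
    and "\<And>x. F x \<in> affine hull (images_at S x)"
    and "\<And>x. norm (F x - metric_proj W x) \<le> \<gamma> * norm (x - metric_proj W x)"
  shows "BAM \<gamma> (CC S) \<and> Fix (CC S) = (\<Inter>i\<in>{1..m}. Fix (T i))"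
proof -
  let ?D = "\<Inter>i\<in>{1..m}. Fix (T i)"
  have S: "finite S" "S \<noteq> {}"
    using assms(5,10) by auto
  have convW: "convex W"
    using assms(8) by (rule affine_imp_convex)
  have proj_mem: "metric_proj W x \<in> W" for x
    using assms(6,7) convW by (intro metric_proj_mem)
  have equidist: "norm (w - V x) = norm (w - x)" if "w \<in> W" "V \<in> S" for w x V
  proof -
    obtain j where j: "j \<in> {1..m}" "V = T j" using \<open>V \<in> S\<close> assms(5) by blast
    then have "T j w = w" using \<open>w \<in> W\<close> assms(9) by (auto simp: Fix_def)
    then show ?thesis using assms(3)[OF j(1)] j(2) unfolding isometry_def by metis
  qed
  have mem: "CC S x \<in> affine hull (images_at S x)" for x
    using S equidist[OF proj_mem] by (rule CC_mem)
  have pyth: "(norm (q - w))\<^sup>2 = (norm (q - CC S x))\<^sup>2 + (norm (CC S x - w))\<^sup>2"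
    if "w \<in> W" "q \<in> affine hull (images_at S x)" for w q x
    using S equidist[OF that(1)] that(2) by (rule CC_pythagoras)
  have x_mem: "x \<in> affine hull (images_at S x)" for x
    using imageI[OF assms(10), of "\<lambda>T. T x"] by (simp add: images_at_eq hull_inc)
  have contr: "norm (CC S x - metric_proj W x) \<le> \<gamma> * norm (x - metric_proj W x)" for x
  proof -
    have "(norm (CC S x - metric_proj W x))\<^sup>2 \<le> (norm (F x - metric_proj W x))\<^sup>2"
      using pyth[OF proj_mem assms(13)] by simp
    then have "norm (CC S x - metric_proj W x) \<le> norm (F x - metric_proj W x)"
      by (rule power2_le_imp_le) simp
    then show ?thesis using assms(14) by (rule order_trans)
  qed
  have fix_W: "x \<in> W" if "CC S x = x" for x
  proof -
    \<comment> \<open>At a fixed point the contraction estimate bounds the distance to the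
      projection by \<gamma> times itself, and \<gamma> is below 1.\<close>
    have "(1 - \<gamma>) * norm (x - metric_proj W x) \<le> 0"
      using contr[of x] that by (simp add: algebra_simps)
    then have "x = metric_proj W x"
      using assms(12) by (simp add: mult_le_0_iff)
    then show ?thesis using proj_mem by metis
  qed
  have fix_D: "CC S x = x" if "x \<in> ?D" for x
  proof -
    have "V x = x" if "V \<in> S" for V
      using that \<open>x \<in> ?D\<close> assms(5) by (auto simp: Fix_def)
    then have "images_at S x = (\<lambda>V. x) ` S"
      unfolding images_at_eq by (intro image_cong) simp_all
    then have "images_at S x = {x}"
      using S(2) by auto
    then show ?thesis using mem[of x] by (simp add: affine_sing hull_same)
  qed
  \<comment> \<open>The inclusions close a cycle: \<open>W\<close> lies in \<open>?D\<close>,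
    \<open>?D\<close> in \<open>Fix (CC S)\<close>, and \<open>Fix (CC S)\<close> in
    \<open>W\<close>.\<close>
  have FixW: "Fix (CC S) = W" and FixD: "Fix (CC S) = ?D"
    using fix_W fix_D assms(9) unfolding Fix_def[of "CC S"] by blast+
  have "metric_proj W (CC S x) = metric_proj W x" for x
  proof -
    \<comment> \<open>For \<open>w\<close> in \<open>W\<close>, the squared distances from
      \<open>x\<close> and from \<open>CC S x\<close> differ by a constant independent of
      \<open>w\<close>, so both points rank the points of \<open>W\<close> alike and their
      descriptions of the nearest point agree.\<close>
    have "norm (CC S x - w) \<le> norm (CC S x - y) \<longleftrightarrow> norm (x - w) \<le> norm (x - y)"
      if "w \<in> W" "y \<in> W" for w y
    proof -
      have "(norm (CC S x - w))\<^sup>2 \<le> (norm (CC S x - y))\<^sup>2 \<longleftrightarrow> (norm (x - w))\<^sup>2 \<le> (norm (x - y))\<^sup>2"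
        using pyth[OF that(1) x_mem[of x]] pyth[OF that(2) x_mem[of x]] by simp
      then show ?thesis by simp
    qed
    then show ?thesis
      unfolding metric_proj_def by (intro arg_cong[where f = The] ext) blast
  qed
  then have "BAM \<gamma> (CC S)"
    unfolding BAM_def FixW using assms(6,7,11,12) convW contr by auto
  then show ?thesis using FixD by blast
qed

end
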